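(* Let $G$ be a graph (or hypergraph) with finite vertex set $V$, and suppose a set of bad colorings is given, where a bad coloring is a pair $(Z,c)$ with $Z\subset V$ and $c$ a coloring of $Z$. Let $\mathcal Z=\{Z_i: i\in I\}$ be the set of all $Z$ for which there is some $c$ such that $(Z,c)$ is a bad coloring, indexed by a finite set $I\subset\mathbb N$, and for $i\in I$ let $C_i=\{c:(Z_i,c)\text{ is a bad coloring}\}$. For each $i\in I$ let $k_i\ge 0$ and $m_i\geq 1$ be integers such that, for every $v\in Z_i$, a fixed set of $k_i$ vertices of $Z_i$ different from $v$ has been chosen with the following property: whatever the colors of these $k_i$ vertices, there are at most $m_i$ ways to extend this partial coloring to a coloring of $Z_i$ belonging to $C_i$. Put $l_i=|Z_i|-k_i$ and $E=\{l\in\mathbb N:\exists i\in I,\ l_i=l\}$. For $l\in E$ and $v\in V$ let $Q_l(v)$ be the set of subsets of $V$ that contain $v$ and are equal to some $Z_j\in\mathcal Z$ with $l_j=l$, and let $d_l=\max_{v\in V}|Q_l(v)|$. Let $\phi_E(x)=1+\sum_{i\in E}x^i$, suppose $\tau>0$ satisfies $\phi_E(\tau)-\tau\phi_E'(\tau)=0$, and let $\gamma=\phi_E'(\tau)$. Then there is a coloring of the vertices of $G$ using $\left\lceil \gamma\,\sup_{i\in I}(d_{l_i}m_i)^{1/l_i}\right\rceil$ colors that avoids all bad colorings, i.e. for no $i\in I$ does its restriction to $Z_i$ belong to $C_i$.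
   Context: Colorings are maps from vertices to the finite palette of available colors, here the palette $\{1,\dots,N\}$ with $N=\lceil \gamma\sup_{i\in I}(d_{l_i}m_i)^{1/l_i}\rceil$; bad colorings are colorings of subsets of $V$ with these colors. No edge structure of $G$ is used beyond what is encoded in the bad colorings. *)

theory Defs
  imports "HOL-Analysis.Analysis" "HOL-Library.FuncSet"
begin

(* Colorings of S with palette {1..N} are extensional functions, so that a coloring of S
   is determined by its values on S and counting colorings with card is meaningful. *)
definition colorings :: "'a set \<Rightarrow> nat \<Rightarrow> ('a \<Rightarrow> nat) set" where
  "colorings S N = S \<rightarrow>\<^sub>E {1..N}"

(* Bad colorings are given as a set B of pairs (W, c), with c a coloring of W. *)
definition bad_sets :: "('a set \<times> ('a \<Rightarrow> nat)) set \<Rightarrow> 'a set set" where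
  "bad_sets B = {W. \<exists>c. (W, c) \<in> B}"

definition bad_on :: "('a set \<times> ('a \<Rightarrow> nat)) set \<Rightarrow> 'a set \<Rightarrow> ('a \<Rightarrow> nat) set" where
  "bad_on B W = {c. (W, c) \<in> B}"

(* Truncated subtraction is harmless for nonempty Z i: the k i chosen vertices lie
   in Z i and differ from some v in Z i, so k i < card (Z i). *)
definition ell :: "(nat \<Rightarrow> 'a set) \<Rightarrow> (nat \<Rightarrow> nat) \<Rightarrow> nat \<Rightarrow> nat" where
  "ell Z k i = card (Z i) - k i"

definition ell_set :: "nat set \<Rightarrow> (nat \<Rightarrow> 'a set) \<Rightarrow> (nat \<Rightarrow> nat) \<Rightarrow> nat set" where
  "ell_set I Z k = {l. \<exists>i\<in>I. ell Z k i = l}"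

definition Q :: "'a set \<Rightarrow> nat set \<Rightarrow> (nat \<Rightarrow> 'a set) \<Rightarrow> (nat \<Rightarrow> nat) \<Rightarrow> nat \<Rightarrow> 'a \<Rightarrow> 'a set set" where
  "Q V I Z k l v = {W. W \<subseteq> V \<and> v \<in> W \<and> (\<exists>j\<in>I. W = Z j \<and> ell Z k j = l)}"

definition max_deg :: "'a set \<Rightarrow> nat set \<Rightarrow> (nat \<Rightarrow> 'a set) \<Rightarrow> (nat \<Rightarrow> nat) \<Rightarrow> nat \<Rightarrow> nat" where
  "max_deg V I Z k l = Max ((\<lambda>v. card (Q V I Z k l v)) ` V)"

definition phi :: "nat set \<Rightarrow> real \<Rightarrow> real" where
  "phi E x = 1 + (\<Sum>i\<in>E. x ^ i)"

definition num_colors ::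
  "'a set \<Rightarrow> nat set \<Rightarrow> (nat \<Rightarrow> 'a set) \<Rightarrow> (nat \<Rightarrow> nat) \<Rightarrow> (nat \<Rightarrow> nat) \<Rightarrow> real \<Rightarrow> nat" where
  "num_colors V I Z k m \<gamma> =
     nat \<lceil>\<gamma> * (SUP i\<in>I. (real (max_deg V I Z k (ell Z k i)) * real (m i)) powr (1 / real (ell Z k i)))\<rceil>"

end

(* Counting in place of entropy compression. Put A = sup_i (d_{l_i} m_i)^(1/l_i) and beta = A/tau.
   By induction on S, adding a vertex v to S multiplies the number of good colorings of S by at
   least beta. Of the N extensions of each good coloring of S, an extension spoiled by W = Z_i is
   determined by its restriction to S - (W - K) together with one of m_i completions on W, and by
   induction S - (W - K), which misses l_i - 1 vertices of S, has at most beta^(1 - l_i) times as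
   many good colorings as S. So it suffices that N >= beta + sum_l A^l beta^(1 - l), and the right
   side equals A phi(tau)/tau = A phi'(tau) = gamma A. The condition on tau means that this choice
   of beta minimizes the right side. *)
theory Submission
  imports Defs
begin

section \<open>Good colorings of vertex subsets and their one-vertex extensions\<close>

text \<open>Only bad sets lying wholly inside \<open>S\<close> are tested, so the notion makes sense
  for partial colorings and passes to subsets. For \<open>S = V\<close> every bad set is
  tested.\<close>

definition good_colorings ::
  "('a set \<times> ('a \<Rightarrow> nat)) set \<Rightarrow> nat \<Rightarrow> 'a set \<Rightarrow> ('a \<Rightarrow> nat) set" where
  "good_colorings B N S =
     {c \<in> colorings S N. \<forall>W. W \<subseteq> S \<longrightarrow> restrict c W \<notin> bad_on B W}"

lemma finite_colorings: "finite S \<Longrightarrow> finite (colorings S N)"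
  by (simp add: colorings_def finite_PiE)

lemma restrict_colorings: "c \<in> colorings S N \<Longrightarrow> T \<subseteq> S \<Longrightarrow> restrict c T \<in> colorings T N"
  unfolding colorings_def restrict_PiE_iff by blast

lemma finite_good_colorings: "finite S \<Longrightarrow> finite (good_colorings B N S)"
  by (simp add: good_colorings_def finite_colorings)

lemma restrict_good_colorings:
  assumes "c \<in> good_colorings B N S" "T \<subseteq> S"
  shows "restrict c T \<in> good_colorings B N T"
  using assms restrict_colorings[of c S N T]
  by (auto simp: good_colorings_def restrict_restrict Int_absorb1)

lemma card_extensions:
  assumes "finite S" "v \<notin> S" "F \<subseteq> colorings S N"
  shows "card {c \<in> colorings (insert v S) N. restrict c S \<in> F} = N * card F"
proof -
  let ?X = "{c \<in> colorings (insert v S) N. restrict c S \<in> F}"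
  have "bij_betw (\<lambda>(a, f). f(v := a)) ({1..N} \<times> F) ?X"
  proof (rule bij_betwI[where g = "\<lambda>c. (c v, restrict c S)"])
    show "(\<lambda>(a, f). f(v := a)) \<in> {1..N} \<times> F \<rightarrow> ?X"
    proof clarsimp
      fix a f assume a: "Suc 0 \<le> a" "a \<le> N" and f: "f \<in> F"
      then have f': "f \<in> S \<rightarrow>\<^sub>E {1..N}"
        using assms(3) by (auto simp: colorings_def)
      then have "restrict (f(v := a)) S = f"
        using assms(2) by (auto simp: fun_eq_iff restrict_def PiE_def extensional_def)
      moreover have "f(v := a) \<in> colorings (insert v S) N"
        unfolding colorings_def using a f' by (intro PiE_fun_upd) auto
      ultimately show "f(v := a) \<in> colorings (insert v S) N \<and> restrict (f(v := a)) S \<in> F"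
        using f by simp
    qed
    show "(\<lambda>c. (c v, restrict c S)) \<in> ?X \<rightarrow> {1..N} \<times> F"
      by (auto simp: colorings_def PiE_def Pi_def)
    fix x assume "x \<in> {1..N} \<times> F"
    then obtain a f where x: "x = (a, f)" "f \<in> colorings S N"
      using assms(3) by auto
    then show "((\<lambda>(a, f). f(v := a)) x v, restrict ((\<lambda>(a, f). f(v := a)) x) S) = x"
      using assms(2) by (auto simp: fun_eq_iff restrict_def colorings_def PiE_def extensional_def)
  next
    fix c assume "c \<in> ?X"
    then show "(\<lambda>(a, f). f(v := a)) (c v, restrict c S) = c"
      by (auto simp: fun_eq_iff restrict_def colorings_def PiE_def extensional_def)
  qed
  then have "card ({1..N} \<times> F) = card ?X"
    by (rule bij_betw_same_card)
  then show ?thesis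
    by (simp add: card_cartesian_product)
qed

text \<open>The set \<open>T = S - (W - K)\<close> forgets the colors of \<open>W\<close> outside
  \<open>K\<close>. Since \<open>K\<close> lies in \<open>T\<close>, a good coloring
  \<open>t\<close> of \<open>T\<close> still fixes the colors on \<open>K\<close>, and
  \<open>ext\<close> leaves at most \<open>M\<close> bad colorings of \<open>W\<close> compatible
  with it.\<close>

lemma card_spoiled_extensions:
  assumes "finite S" "v \<in> W" "W \<subseteq> insert v S" "K \<subseteq> W - {v}" "bad_on B W \<subseteq> colorings W N"
    and ext: "\<And>\<sigma>. \<sigma> \<in> colorings K N \<Longrightarrow> card {c \<in> bad_on B W. restrict c K = \<sigma>} \<le> M"
  shows "card {c \<in> colorings (insert v S) N.
            restrict c S \<in> good_colorings B N S \<and> restrict c W \<in> bad_on B W}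
          \<le> M * card (good_colorings B N (S - (W - K)))" (is "card ?X \<le> M * card ?G")
proof -
  define T where "T = S - (W - K)"
  let ?R = "\<lambda>t. {b \<in> bad_on B W. restrict b K = restrict t K}"
  have KT: "K \<subseteq> T" and TS: "T \<subseteq> S" and TW: "insert v S = T \<union> W"
    using assms(2-4) by (auto simp: T_def)
  have finW: "finite W"
    using assms(1,3) finite_subset by auto
  have finR: "finite (?R t)" for t
    using finite_subset[OF assms(5) finite_colorings[OF finW]] by simp
  have finG: "finite ?G"
    using assms(1) by (simp add: finite_good_colorings)
  \<comment> \<open>The two restrictions determine \<open>c\<close> because \<open>T\<close> and
    \<open>W\<close> cover \<open>insert v S\<close>.\<close>
  have inj: "inj_on (\<lambda>c. (restrict c T, restrict c W)) ?X"
  proof (rule inj_onI)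
    fix c c' assume c: "c \<in> ?X" "c' \<in> ?X"
      and eq: "(restrict c T, restrict c W) = (restrict c' T, restrict c' W)"
    have "c x = c' x" if "x \<in> insert v S" for x
      using that eq unfolding TW by (metis Pair_inject UnE restrict_apply')
    then show "c = c'"
      using c unfolding colorings_def by (blast intro: PiE_ext)
  qed
  have "(\<lambda>c. (restrict c T, restrict c W)) ` ?X \<subseteq> (SIGMA t : ?G. ?R t)"
  proof (rule image_subsetI)
    fix c assume c: "c \<in> ?X"
    then have g: "restrict c S \<in> good_colorings B N S"
      by simp
    have "restrict (restrict c S) T \<in> good_colorings B N T"
      using restrict_good_colorings[OF g TS] .
    moreover have "restrict (restrict c S) T = restrict c T"
      using TS by (simp add: restrict_restrict Int_absorb1)
    moreover have "K \<subseteq> W"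
      using assms(4) by auto
    ultimately show "(restrict c T, restrict c W) \<in> (SIGMA t : ?G. ?R t)"
      using c KT by (simp add: restrict_restrict Int_absorb1 T_def)
  qed
  then have "card ?X \<le> card (SIGMA t : ?G. ?R t)"
    by (rule card_inj_on_le[OF inj]) (use finR finG in auto)
  also have "\<dots> = (\<Sum>t\<in>?G. card (?R t))"
    using finR finG by simp
  also have "\<dots> \<le> (\<Sum>t\<in>?G. M)"
    using KT by (intro sum_mono ext restrict_colorings[of _ T]) (auto simp: good_colorings_def T_def)
  finally show ?thesis
    by (simp add: mult.commute)
qed

section \<open>Growth of the number of good colorings\<close>

text \<open>The elements of \<open>D\<close> are added to \<open>T\<close> one at a time, each
  gaining a factor \<open>\<beta>\<close>. Growth is assumed only from proper subsets of
  \<open>T \<union> D\<close>, so that the hypothesis can be supplied by a strong induction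
  hypothesis for the set \<open>T \<union> D\<close>.\<close>

lemma power_growth:
  fixes f :: "'a set \<Rightarrow> real"
  assumes "finite D" "T \<inter> D = {}" "\<beta> \<ge> 0"
    and "\<And>R u. R \<subset> T \<union> D \<Longrightarrow> u \<in> T \<union> D - R \<Longrightarrow> \<beta> * f R \<le> f (insert u R)"
  shows "\<beta> ^ card D * f T \<le> f (T \<union> D)"
  using assms
proof (induction D rule: finite_induct)
  case (insert u D)
  have "\<beta> ^ card D * f T \<le> f (T \<union> D)"
    using insert.prems by (intro insert.IH) auto
  then have "\<beta> * (\<beta> ^ card D * f T) \<le> \<beta> * f (T \<union> D)"
    using insert.prems by (simp add: mult_left_mono)
  also have "\<dots> \<le> f (insert u (T \<union> D))"
    using insert by (intro insert.prems(3)) auto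
  finally show ?case
    using insert.hyps by simp
qed simp

text \<open>This is a union bound over the bad sets through \<open>v\<close>. The assumption
  \<open>N\<close> says that the palette pays for the factor \<open>\<beta>\<close> plus the
  relative loss caused by each such set.\<close>

lemma good_colorings_growth:
  fixes \<beta> :: real and M :: "'a set \<Rightarrow> nat" and K :: "'a set \<Rightarrow> 'a \<Rightarrow> 'a set"
  assumes finV: "finite V" and pos: "\<beta> > 0"
    and bad: "\<And>W c. (W, c) \<in> B \<Longrightarrow> W \<subseteq> V \<and> c \<in> colorings W N"
    and K: "\<And>W v. W \<in> bad_sets B \<Longrightarrow> v \<in> W \<Longrightarrow> K W v \<subseteq> W - {v}"
    and ext: "\<And>W v \<sigma>. W \<in> bad_sets B \<Longrightarrow> v \<in> W \<Longrightarrow> \<sigma> \<in> colorings (K W v) N \<Longrightarrow>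
                card {c \<in> bad_on B W. restrict c (K W v) = \<sigma>} \<le> M W"
    and N: "\<And>v. v \<in> V \<Longrightarrow>
      \<beta> + (\<Sum>W | W \<in> bad_sets B \<and> v \<in> W. M W / \<beta> ^ card (W - insert v (K W v))) \<le> N"
    and S: "S \<subseteq> V" "v \<in> V - S"
  shows "\<beta> * card (good_colorings B N S) \<le> card (good_colorings B N (insert v S))"
  using finite_subset[OF S(1) finV] S
\<comment> \<open>Strong induction is needed because the bound for a bad set compares
  \<open>S\<close> with a subset that may miss many of its vertices.\<close>
proof (induction S arbitrary: v rule: finite_psubset_induct)
  case (psubset S)
  let ?G = "good_colorings B N"
  define X where "X = {c \<in> colorings (insert v S) N. restrict c S \<in> ?G S}"
  define Y where "Y W = {c \<in> colorings (insert v S) N.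
      restrict c S \<in> ?G S \<and> restrict c W \<in> bad_on B W}" for W
  define \<W> where "\<W> = {W. W \<in> bad_sets B \<and> v \<in> W}"
  \<comment> \<open>Only bad sets inside \<open>insert v S\<close> can spoil an extension. The sum
    over them is later enlarged to all of \<open>\<W>\<close>, which adds only nonnegative
    terms.\<close>
  define \<W>' where "\<W>' = {W \<in> \<W>. W \<subseteq> insert v S}"
  have "bad_sets B \<subseteq> Pow V"
    using bad by (auto simp: bad_sets_def)
  then have fin: "finite \<W>" "finite \<W>'"
    using finV by (auto simp: \<W>_def \<W>'_def intro: finite_subset)
  have finX: "finite X" "finite (Y W)" for W
    using psubset.hyps by (auto simp: X_def Y_def finite_colorings)
  have cardX: "card X = N * card (?G S)"
    unfolding X_def using psubset by (intro card_extensions) (auto simp: good_colorings_def)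
  have cardY: "card (Y W) \<le> M W / \<beta> ^ card (W - insert v (K W v)) * card (?G S)"
    if "W \<in> \<W>'" for W
  proof -
    from that have W: "W \<in> bad_sets B" "v \<in> W" "W \<subseteq> insert v S"
      by (auto simp: \<W>_def \<W>'_def)
    let ?T = "S - (W - K W v)" and ?D = "W - insert v (K W v)"
    \<comment> \<open>As \<open>v\<close> is outside \<open>S\<close>, the vertices of
      \<open>S\<close> missing from \<open>?T\<close> are exactly those of \<open>?D\<close>.
      Growing from \<open>?T\<close> back to \<open>S\<close> thus gains \<open>card ?D\<close>
      factors, which bounds the good colorings of \<open>?T\<close> from above.\<close>
    have TD: "?T \<union> ?D = S" "?T \<inter> ?D = {}"
      using W K[OF W(1,2)] psubset.prems by auto
    have "\<beta> ^ card ?D * card (?G ?T) \<le> card (?G (?T \<union> ?D))"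
    proof (rule power_growth)
      show "finite ?D"
        using W(3) psubset.hyps(1) by (meson finite.insertI finite_Diff finite_subset)
      fix R u assume "R \<subset> ?T \<union> ?D" "u \<in> ?T \<union> ?D - R"
      then show "\<beta> * card (?G R) \<le> card (?G (insert u R))"
        unfolding TD using psubset.prems by (intro psubset.IH) auto
    qed (use TD pos in auto)
    then have T: "card (?G ?T) \<le> card (?G S) / \<beta> ^ card ?D"
      unfolding TD using pos by (simp add: field_simps)
    have "bad_on B W \<subseteq> colorings W N"
      using bad by (auto simp: bad_on_def)
    then have "card (Y W) \<le> M W * card (?G ?T)"
      unfolding Y_def using W psubset.hyps K ext by (intro card_spoiled_extensions) auto
    then have "real (card (Y W)) \<le> M W * real (card (?G ?T))"
      by (metis of_nat_le_iff of_nat_mult)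
    also have "\<dots> \<le> M W * (card (?G S) / \<beta> ^ card ?D)"
      using T by (intro mult_left_mono) auto
    finally show ?thesis
      by simp
  qed
  have sub: "X \<subseteq> ?G (insert v S) \<union> (\<Union>W\<in>\<W>'. Y W)"
  proof
    fix c assume c: "c \<in> X"
    show "c \<in> ?G (insert v S) \<union> (\<Union>W\<in>\<W>'. Y W)"
    proof (cases "c \<in> ?G (insert v S)")
      case False
      then obtain W where W: "W \<subseteq> insert v S" "restrict c W \<in> bad_on B W"
        using c by (auto simp: good_colorings_def X_def)
      \<comment> \<open>A bad set avoiding \<open>v\<close> would already spoil the restriction of
        \<open>c\<close> to \<open>S\<close>, which is good.\<close>
      have "v \<in> W"
      proof (rule ccontr)
        assume "v \<notin> W"
        then have "W \<subseteq> S"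
          using W by auto
        moreover have "restrict (restrict c S) W = restrict c W"
          using calculation by (simp add: restrict_restrict Int_absorb1)
        ultimately show False
          using c W by (auto simp: X_def good_colorings_def)
      qed
      then have "W \<in> \<W>'"
        using W by (auto simp: \<W>'_def \<W>_def bad_sets_def bad_on_def)
      then show ?thesis
        using c W by (auto simp: X_def Y_def)
    qed simp
  qed
  have "card X \<le> card (?G (insert v S) \<union> (\<Union>W\<in>\<W>'. Y W))"
    using sub finX fin psubset.hyps by (intro card_mono) (auto simp: finite_good_colorings)
  also have "\<dots> \<le> card (?G (insert v S)) + (\<Sum>W\<in>\<W>'. card (Y W))"
    using card_Un_le[of "?G (insert v S)" "\<Union>W\<in>\<W>'. Y W"] card_UN_le[OF fin(2), of Y] by linarith
  finally have "real (card X) \<le> card (?G (insert v S)) + (\<Sum>W\<in>\<W>'. real (card (Y W)))"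
    by (metis of_nat_add of_nat_le_iff of_nat_sum)
  moreover have "(\<Sum>W\<in>\<W>'. real (card (Y W)))
      \<le> (\<Sum>W\<in>\<W>'. M W / \<beta> ^ card (W - insert v (K W v)) * card (?G S))"
    by (intro sum_mono cardY)
  moreover have "\<dots> \<le> (\<Sum>W\<in>\<W>. M W / \<beta> ^ card (W - insert v (K W v)) * card (?G S))"
    using fin pos by (intro sum_mono2) (auto simp: \<W>'_def)
  moreover have "(\<beta> + (\<Sum>W\<in>\<W>. M W / \<beta> ^ card (W - insert v (K W v)))) * card (?G S)
      \<le> real N * card (?G S)"
    using N[of v] psubset.prems by (intro mult_right_mono) (auto simp: \<W>_def)
  ultimately show ?case
    by (simp add: cardX ring_distribs sum_distrib_right)
qed

text \<open>Growing from the empty set to \<open>V\<close> yields at least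
  \<open>\<beta> ^ card V\<close> good colorings, a positive number.\<close>

lemma exists_good_coloring:
  fixes \<beta> :: real and M :: "'a set \<Rightarrow> nat" and K :: "'a set \<Rightarrow> 'a \<Rightarrow> 'a set"
  assumes finV: "finite V" and pos: "\<beta> > 0"
    and bad: "\<And>W c. (W, c) \<in> B \<Longrightarrow> W \<subseteq> V \<and> W \<noteq> {} \<and> c \<in> colorings W N"
    and K: "\<And>W v. W \<in> bad_sets B \<Longrightarrow> v \<in> W \<Longrightarrow> K W v \<subseteq> W - {v}"
    and ext: "\<And>W v \<sigma>. W \<in> bad_sets B \<Longrightarrow> v \<in> W \<Longrightarrow> \<sigma> \<in> colorings (K W v) N \<Longrightarrow>
                card {c \<in> bad_on B W. restrict c (K W v) = \<sigma>} \<le> M W"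
    and N: "\<And>v. v \<in> V \<Longrightarrow>
      \<beta> + (\<Sum>W | W \<in> bad_sets B \<and> v \<in> W. M W / \<beta> ^ card (W - insert v (K W v))) \<le> N"
  shows "good_colorings B N V \<noteq> {}"
proof -
  have "\<beta> ^ card V * card (good_colorings B N {}) \<le> card (good_colorings B N ({} \<union> V))"
  proof (rule power_growth)
    fix R u assume "R \<subset> {} \<union> V" "u \<in> {} \<union> V - R"
    then show "\<beta> * card (good_colorings B N R) \<le> card (good_colorings B N (insert u R))"
      by (intro good_colorings_growth[where V = V and M = M and K = K])
        (use finV pos bad K ext N in auto)
  qed (use finV pos in auto)
  \<comment> \<open>The empty coloring is the everywhere undefined function; it is good because
    every bad set is nonempty.\<close>
  moreover have "good_colorings B N {} = {\<lambda>_. undefined}"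
    using bad by (auto simp: good_colorings_def colorings_def bad_on_def)
  ultimately have "card (good_colorings B N V) > 0"
    using pos by (metis One_nat_def card.empty card_insert_disjoint empty_iff finite.emptyI mult.right_neutral
        not_gr_zero not_le of_nat_0 of_nat_1 sup_bot_left zero_less_power)
  then show ?thesis
    by force
qed

section \<open>Choice of beta and verification of the local condition\<close>

text \<open>Nonemptiness of bad sets excludes a bad coloring of the empty set, which no coloring
  could avoid. The palette size \<open>N\<close> occurs in the hypotheses on colorings and is fixed
  by the last assumption.\<close>

theorem mainTheorem1:
  fixes V :: "'a set"
    and B :: "('a set \<times> ('a \<Rightarrow> nat)) set"
    and I :: "nat set"
    and Z :: "nat \<Rightarrow> 'a set"
    and k m :: "nat \<Rightarrow> nat"
    and K :: "nat \<Rightarrow> 'a \<Rightarrow> 'a set"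
    and \<tau> \<gamma> :: real
    and N :: nat
  assumes finV: "finite V"
    and bad: "\<And>W c. (W, c) \<in> B \<Longrightarrow> W \<subseteq> V \<and> W \<noteq> {} \<and> c \<in> colorings W N"
    and finI: "finite I"
    and Z: "bad_sets B = Z ` I"
    and m: "\<And>i. i \<in> I \<Longrightarrow> m i \<ge> 1"
    and K: "\<And>i v. i \<in> I \<Longrightarrow> v \<in> Z i \<Longrightarrow> K i v \<subseteq> Z i - {v} \<and> card (K i v) = k i"
    and ext: "\<And>i v \<sigma>. i \<in> I \<Longrightarrow> v \<in> Z i \<Longrightarrow> \<sigma> \<in> colorings (K i v) N \<Longrightarrow>
                card {c \<in> bad_on B (Z i). restrict c (K i v) = \<sigma>} \<le> m i"
    and tau_pos: "\<tau> > 0"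
    and tau: "phi (ell_set I Z k) \<tau> - \<tau> * deriv (phi (ell_set I Z k)) \<tau> = 0"
    and gamma: "\<gamma> = deriv (phi (ell_set I Z k)) \<tau>"
    and N: "N = num_colors V I Z k m \<gamma>"
  shows "\<exists>c \<in> colorings V N. \<forall>i\<in>I. restrict c (Z i) \<notin> bad_on B (Z i)"
proof -
  define E where "E = ell_set I Z k"
  define d where "d l = max_deg V I Z k l" for l
  define l where "l i = ell Z k i" for i
  define A where "A = (SUP i\<in>I. (real (d (l i)) * real (m i)) powr (1 / real (l i)))"
  define \<beta> where "\<beta> = A / \<tau>"
  have finE: "finite E"
    using finI by (simp add: E_def ell_set_def)
  have Z_bad: "Z i \<in> bad_sets B" if "i \<in> I" for i
    using Z that by blast
  have Z_sub: "Z i \<subseteq> V" "Z i \<noteq> {}" if "i \<in> I" for i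
    using Z_bad[OF that] bad by (auto simp: bad_sets_def)
  have finZ: "finite (Z i)" if "i \<in> I" for i
    using Z_sub[OF that] finV finite_subset by blast
  \<comment> \<open>The exponent is \<open>l i - 1\<close> because \<open>v\<close> is removed along
    with the \<open>k i\<close> chosen vertices. The same count gives \<open>l i > 0\<close>, so no
    subtraction is truncated.\<close>
  have card_diff: "card (Z i - insert v (K i v)) = l i - 1" "l i > 0" if "i \<in> I" "v \<in> Z i" for i v
  proof -
    have f: "finite (insert v (K i v))" "insert v (K i v) \<subseteq> Z i"
      using K[OF that] finZ[OF that(1)] that(2) by (auto intro: finite_subset)
    then have c: "card (insert v (K i v)) = Suc (k i)"
      using K[OF that] by (subst card_insert_disjoint) auto
    show "card (Z i - insert v (K i v)) = l i - 1"
      using f c by (simp add: card_Diff_subset l_def ell_def)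
    show "l i > 0"
      using card_mono[OF finZ[OF that(1)] f(2)] c by (simp add: l_def ell_def)
  qed
  have d_max: "card (Q V I Z k j v) \<le> d j" if "v \<in> V" for j v
    using that finV by (simp add: d_def max_deg_def)
  have finQ: "finite (Q V I Z k j v)" for j v
    using finV by (auto simp: Q_def intro: finite_subset[of _ "Pow V"])
  \<comment> \<open>For any \<open>v\<close> in \<open>Z i\<close>, the set \<open>Z i\<close> is
    itself a member of \<open>Q V I Z k (l i) v\<close>.\<close>
  have d_pos: "d (l i) > 0" and l_pos: "l i > 0" if i: "i \<in> I" for i
  proof -
    obtain v where v: "v \<in> Z i"
      using Z_sub[OF i] by auto
    then have "Z i \<in> Q V I Z k (l i) v"
      using i Z_sub[OF i] by (auto simp: Q_def l_def)
    then have "card (Q V I Z k (l i) v) > 0"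
      using finQ card_gt_0_iff by blast
    then show "d (l i) > 0"
      using d_max[of v "l i"] Z_sub[OF i] v by (metis gr0I le_0_eq less_irrefl subsetD)
    show "l i > 0"
      using card_diff i v by blast
  qed
  have dm_le: "real (d (l i)) * real (m i) \<le> A ^ l i" and A_pos: "A > 0" if i: "i \<in> I" for i
  proof -
    define x where "x = real (d (l i)) * real (m i)"
    have x: "x > 0"
      using d_pos[OF i] m[OF i] by (simp add: x_def)
    have le: "x powr (1 / l i) \<le> A"
      unfolding A_def x_def using i finI by (intro cSUP_upper) auto
    with x show "A > 0"
      by (smt (verit) powr_gt_zero)
    have "x = (x powr (1 / l i)) ^ l i"
      using x l_pos[OF i] by (simp add: powr_power)
    also have "\<dots> \<le> A ^ l i"
      using le by (intro power_mono) auto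
    finally show "real (d (l i)) * real (m i) \<le> A ^ l i"
      unfolding x_def .
  qed
  \<comment> \<open>For empty \<open>I\<close> the function \<open>phi\<close> is constantly 1 and
    the equation for \<open>\<tau>\<close> would read 1 = 0.\<close>
  have "I \<noteq> {}"
  proof
    assume "I = {}"
    then have "phi (ell_set I Z k) = (\<lambda>x. 1)"
      by (auto simp: phi_def ell_set_def)
    with tau show False
      by simp
  qed
  then have "A > 0"
    using A_pos by blast
  then have \<beta>_pos: "\<beta> > 0"
    using tau_pos by (simp add: \<beta>_def)
  have "\<gamma> * A \<le> N"
    unfolding N num_colors_def A_def d_def l_def by linarith
  \<comment> \<open>The equation for \<open>\<tau>\<close> replaces the derivative by
    \<open>phi E \<tau> / \<tau>\<close>, and \<open>A / \<tau>\<close> is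
    \<open>\<beta>\<close>.\<close>
  moreover have "\<gamma> * A = \<beta> * phi E \<tau>"
    using tau tau_pos by (simp add: gamma E_def \<beta>_def)
  ultimately have \<beta>N: "\<beta> * phi E \<tau> \<le> N"
    by simp
  \<comment> \<open>Several indices may name the same set, so each bad set gets one chosen index,
    whose \<open>K\<close> and \<open>m\<close> are used throughout.\<close>
  define idx where "idx = inv_into I Z"
  have idx: "idx W \<in> I" "Z (idx W) = W" if "W \<in> bad_sets B" for W
    using that unfolding Z idx_def by (auto simp: inv_into_into f_inv_into_f)
  have "good_colorings B N V \<noteq> {}"
  proof (rule exists_good_coloring)
    show "K (idx W) v \<subseteq> W - {v}" if "W \<in> bad_sets B" "v \<in> W" for W v
      using K[of "idx W" v] idx[OF that(1)] that by simp
    show "card {c \<in> bad_on B W. restrict c (K (idx W) v) = \<sigma>} \<le> m (idx W)"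
      if "W \<in> bad_sets B" "v \<in> W" "\<sigma> \<in> colorings (K (idx W) v) N" for W v \<sigma>
      using ext[of "idx W" v \<sigma>] idx[OF that(1)] that by simp
    fix v assume v: "v \<in> V"
    let ?\<W> = "{W. W \<in> bad_sets B \<and> v \<in> W}"
    let ?t = "\<lambda>W. m (idx W) / \<beta> ^ card (W - insert v (K (idx W) v))"
    have "bad_sets B \<subseteq> Pow V"
      using bad by (auto simp: bad_sets_def)
    then have fin: "finite ?\<W>"
      using finV by (auto intro: finite_subset)
    \<comment> \<open>The sets through \<open>v\<close> with parameter \<open>j\<close> number at
      most \<open>d j\<close>, and each has \<open>m\<close> at most \<open>A ^ j / d j\<close>, so
      the factor \<open>d j\<close> cancels.\<close>
    have inner: "(\<Sum>W | W \<in> ?\<W> \<and> l (idx W) = j. ?t W) \<le> \<beta> * \<tau> ^ j" if "j \<in> E" for j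
    proof -
      from that obtain i where i: "i \<in> I" "l i = j"
        by (auto simp: E_def ell_set_def l_def)
      have dj: "d j > 0" and j: "j > 0"
        using d_pos l_pos i by auto
      \<comment> \<open>This is \<open>A = \<beta> * \<tau>\<close> raised to the power
        \<open>j\<close>; \<open>j > 0\<close> makes \<open>j - 1\<close> a true
        predecessor.\<close>
      have AE: "A ^ j / \<beta> ^ (j - 1) = \<beta> * \<tau> ^ j"
        using j tau_pos \<open>A > 0\<close>
        by (cases j) (auto simp: \<beta>_def field_simps power_divide)
      have "?t W \<le> \<beta> * \<tau> ^ j / d j" if W: "W \<in> ?\<W>" "l (idx W) = j" for W
      proof -
        have "card (W - insert v (K (idx W) v)) = j - 1"
          using card_diff(1)[of "idx W" v] idx[of W] W by auto
        moreover have "m (idx W) \<le> A ^ j / d j"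
          using dm_le[of "idx W"] idx[of W] W dj by (simp add: field_simps)
        ultimately have "?t W \<le> A ^ j / d j / \<beta> ^ (j - 1)"
          using \<beta>_pos divide_right_mono[of "m (idx W)" "A ^ j / d j" "\<beta> ^ (j - 1)"] by simp
        then show ?thesis
          by (simp flip: AE add: mult.commute)
      qed
      then have "(\<Sum>W | W \<in> ?\<W> \<and> l (idx W) = j. ?t W)
          \<le> card {W. W \<in> ?\<W> \<and> l (idx W) = j} * (\<beta> * \<tau> ^ j / d j)"
        by (intro sum_bounded_above) auto
      also have "\<dots> \<le> d j * (\<beta> * \<tau> ^ j / d j)"
      proof (intro mult_right_mono)
        have "{W. W \<in> ?\<W> \<and> l (idx W) = j} \<subseteq> Q V I Z k j v"
          unfolding Q_def l_def using idx Z_sub by fastforce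
        then show "real (card {W. W \<in> ?\<W> \<and> l (idx W) = j}) \<le> d j"
          using card_mono[OF finQ] d_max[OF v, of j] by (meson le_trans of_nat_mono)
      qed (use \<beta>_pos tau_pos in auto)
      finally show ?thesis
        using dj by simp
    qed
    have "(\<lambda>W. l (idx W)) ` ?\<W> \<subseteq> E"
      using idx by (auto simp: E_def ell_set_def l_def)
    \<comment> \<open>Grouping by \<open>l\<close> turns the sum over bad sets into the sum over
      \<open>E\<close> that occurs in \<open>phi\<close>.\<close>
    then have "(\<Sum>W\<in>?\<W>. ?t W) = (\<Sum>j\<in>E. \<Sum>W | W \<in> ?\<W> \<and> l (idx W) = j. ?t W)"
      by (rule sum.group[OF fin finE, symmetric])
    also have "\<dots> \<le> (\<Sum>j\<in>E. \<beta> * \<tau> ^ j)"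
      by (intro sum_mono inner)
    finally show "\<beta> + (\<Sum>W\<in>?\<W>. ?t W) \<le> N"
      using \<beta>N by (simp add: phi_def sum_distrib_left distrib_left)
  qed (use finV \<beta>_pos bad in auto)
  then show ?thesis
    using Z_sub(1) by (fastforce simp: good_colorings_def)
qed

end
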